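(* Let $n\ge 1$ and let $L$ be one of the following algebras: (a) the complex Heisenberg Leibniz algebra $\mathfrak{l}_{2n+1}^{J_a}$ for some $a\in\mathbb{C}$; (b) the real Heisenberg Leibniz algebra $\mathfrak{l}_5^R$, where $R=\begin{pmatrix} a & b\\ -b & a\end{pmatrix}$ with $a,b\in\mathbb{R}$ and $b\ne 0$; (c) the Kronecker Leibniz algebra $\mathfrak{k}_n$ over a field $\mathbb{F}$ with $\operatorname{char}(\mathbb{F})\neq 2$; (d) the Dieudonné Leibniz algebra $\mathfrak{d}_n$ over a field $\mathbb{F}$ with $\operatorname{char}(\mathbb{F})\neq 2$. Then the Lie algebra $\operatorname{Der}(L)$ of derivations of $L$ has trivial center, and the ideal $\operatorname{Inn}(L)$ of inner derivations of $L$ is abelian.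
   Context: A derivation of an algebra $L$ with bracket $[-,-]$ is a linear map $d\colon L\to L$ with $d([x,y])=[d(x),y]+[x,d(y)]$ for all $x,y\in L$; $\operatorname{Der}(L)$ is the Lie algebra of derivations under $[d_1,d_2]=d_1\circ d_2-d_2\circ d_1$. All algebras below are left Leibniz algebras, i.e. $[x,[y,z]]=[[x,y],z]+[y,[x,z]]$; hence each left multiplication $\operatorname{ad}_x=[x,-]$ is a derivation, called inner, and $\operatorname{Inn}(L)=\{\operatorname{ad}_x : x\in L\}$ is an ideal of $\operatorname{Der}(L)$. Definitions of the algebras, by the nonzero values of the bilinear bracket on basis elements: $\mathfrak{l}_{2n+1}^{J_a}$ over $\mathbb{C}$: basis $\{e_1,\dots,e_n,f_1,\dots,f_n,z\}$; $[e_i,f_i]=(1+a)z$, $[f_i,e_i]=(-1+a)z$ for $i=1,\dots,n$; $[e_i,f_{i-1}]=[f_{i-1},e_i]=z$ for $i=2,\dots,n$. $\mathfrak{l}_5^R$ over $\mathbb{R}$: basis $\{e_1,f_1,e_2,f_2,z\}$; $[e_i,f_i]=(1+a)z$, $[f_i,e_i]=(-1+a)z$ for $i=1,2$; $[e_1,f_2]=[f_2,e_1]=bz$; $[e_2,f_1]=[f_1,e_2]=-bz$. $\mathfrak{k}_n$ over $\mathbb{F}$: basis $\{e_1,\dots,e_n,f_1,\dots,f_n,z\}$; $[e_i,f_i]=[f_i,e_i]=z$ for $i=1,\dots,n$; $[e_i,f_{i-1}]=z$, $[f_{i-1},e_i]=-z$ for $i=2,\dots,n$. $\mathfrak{d}_n$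 over $\mathbb{F}$: basis $\{e_1,\dots,e_{2n+1},z\}$; $[e_1,e_{n+2}]=z$; $[e_i,e_{n+i}]=[e_i,e_{n+i+1}]=z$ for $i=2,\dots,n$; $[e_{n+1},e_{2n+1}]=z$; $[e_i,e_{i-n}]=z$, $[e_i,e_{i-n-1}]=-z$ for $i=n+2,\dots,2n+1$. *)

theory Defs
  imports Complex_Main
begin

section \<open>Algebras, derivations\<close>

text \<open>An algebra lives on a whole type \<^typ>\<open>'v\<close>, its vector space structure being given by
  \<^term>\<open>scale\<close>; the dimension is fixed by the bases assumed below.\<close>

locale bracket_algebra = vector_space scale
  for scale :: "'a::field \<Rightarrow> 'v::ab_group_add \<Rightarrow> 'v" +
  fixes br :: "'v \<Rightarrow> 'v \<Rightarrow> 'v"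
  assumes linear_right: "Vector_Spaces.linear scale scale (\<lambda>y. br x y)"
    and linear_left: "Vector_Spaces.linear scale scale (\<lambda>x. br x y)"

locale left_leibniz_algebra = bracket_algebra +
  assumes left_leibniz: "br x (br y w) = br (br x y) w + br y (br x w)"

definition Der :: "('a::field \<Rightarrow> 'v::ab_group_add \<Rightarrow> 'v) \<Rightarrow> ('v \<Rightarrow> 'v \<Rightarrow> 'v) \<Rightarrow> ('v \<Rightarrow> 'v) set"
  where "Der scale br =
    {d. Vector_Spaces.linear scale scale d \<and> (\<forall>x y. d (br x y) = br (d x) y + br x (d y))}"

definition ad :: "('v \<Rightarrow> 'v \<Rightarrow> 'v) \<Rightarrow> 'v \<Rightarrow> ('v \<Rightarrow> 'v)"
  where "ad br x = (\<lambda>y. br x y)"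

definition Inn :: "('v \<Rightarrow> 'v \<Rightarrow> 'v) \<Rightarrow> ('v \<Rightarrow> 'v) set"
  where "Inn br = {ad br x | x. True}"

definition commutator :: "('v::ab_group_add \<Rightarrow> 'v) \<Rightarrow> ('v \<Rightarrow> 'v) \<Rightarrow> ('v \<Rightarrow> 'v)"
  where "commutator d d' = (\<lambda>x. (d \<circ> d') x - (d' \<circ> d) x)"

text \<open>Center and commutativity, for a set of endomorphisms with the commutator as Lie bracket.\<close>

definition lie_center :: "('v::ab_group_add \<Rightarrow> 'v) set \<Rightarrow> ('v \<Rightarrow> 'v) set"
  where "lie_center D = {d \<in> D. \<forall>d'\<in>D. commutator d d' = (\<lambda>x. 0)}"

definition lie_abelian :: "('v::ab_group_add \<Rightarrow> 'v) set \<Rightarrow> bool"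
  where "lie_abelian D \<longleftrightarrow> (\<forall>d\<in>D. \<forall>d'\<in>D. commutator d d' = (\<lambda>x. 0))"

lemma (in left_leibniz_algebra) Inn_subset_Der: "Inn br \<subseteq> Der scale br"
  using linear_right left_leibniz by (auto simp: Inn_def Der_def ad_def)

lemma (in left_leibniz_algebra) Inn_ideal:
  assumes "d \<in> Der scale br"
  shows "commutator d (ad br x) = ad br (d x)"
  using assms by (auto simp: Der_def commutator_def ad_def fun_eq_iff)

lemma (in bracket_algebra) commutator_Der:
  assumes d: "d \<in> Der scale br" and d': "d' \<in> Der scale br"
  shows "commutator d d' \<in> Der scale br"
proof -
  interpret right: Vector_Spaces.linear scale scale "\<lambda>y. br x y" for x by (rule linear_right)
  interpret left: Vector_Spaces.linear scale scale "\<lambda>x. br x y" for y by (rule linear_left)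
  interpret d: Vector_Spaces.linear scale scale d using d by (simp add: Der_def)
  interpret d': Vector_Spaces.linear scale scale d' using d' by (simp add: Der_def)
  interpret vector_space_pair scale scale ..
  have "Vector_Spaces.linear scale scale (\<lambda>x. d (d' x) - d' (d x))"
    using linear_compose_sub[OF Vector_Spaces.linear_compose[OF d'.linear_axioms d.linear_axioms]
      Vector_Spaces.linear_compose[OF d.linear_axioms d'.linear_axioms]] by (simp add: o_def)
  then show ?thesis using d d'
    by (auto simp: Der_def commutator_def d.add d'.add right.diff left.diff algebra_simps)
qed


section \<open>The algebras\<close>

definition (in vector_space) is_basis :: "'b list \<Rightarrow> bool"
  where "is_basis vs \<longleftrightarrow> distinct vs \<and> independent (set vs) \<and> span (set vs) = UNIV"

abbreviation basis_ef :: "nat \<Rightarrow> (nat \<Rightarrow> 'v) \<Rightarrow> (nat \<Rightarrow> 'v) \<Rightarrow> 'v \<Rightarrow> 'v list"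
  where "basis_ef n e f z \<equiv> map e [1..<n+1] @ map f [1..<n+1] @ [z]"

abbreviation basis_e :: "nat \<Rightarrow> (nat \<Rightarrow> 'v) \<Rightarrow> 'v \<Rightarrow> 'v list"
  where "basis_e m e z \<equiv> map e [1..<m+1] @ [z]"

text \<open>In each locale the bracket is given on all pairs of basis vectors, the products that are not
  listed in the informal definition being zero.  Values of the families \<^term>\<open>e\<close> and
  \<^term>\<open>f\<close> outside the stated index ranges are irrelevant.\<close>

locale heisenberg_J = bracket_algebra scale br
  for scale :: "complex \<Rightarrow> 'v::ab_group_add \<Rightarrow> 'v" and br +
  fixes n :: nat and a :: complex and e f :: "nat \<Rightarrow> 'v" and z :: 'v
  assumes basis: "is_basis (basis_ef n e f z)"
    and ef: "\<lbrakk>i \<in> {1..n}; j \<in> {1..n}\<rbrakk> \<Longrightarrow> br (e i) (f j) =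
      (if i = j then scale (1 + a) z else if i = j + 1 then z else 0)"
    and fe: "\<lbrakk>i \<in> {1..n}; j \<in> {1..n}\<rbrakk> \<Longrightarrow> br (f j) (e i) =
      (if i = j then scale (- 1 + a) z else if i = j + 1 then z else 0)"
    and ee: "\<lbrakk>i \<in> {1..n}; j \<in> {1..n}\<rbrakk> \<Longrightarrow> br (e i) (e j) = 0"
    and ff: "\<lbrakk>i \<in> {1..n}; j \<in> {1..n}\<rbrakk> \<Longrightarrow> br (f i) (f j) = 0"
    and z: "v \<in> set (basis_ef n e f z) \<Longrightarrow> br v z = 0 \<and> br z v = 0"

locale heisenberg_R = bracket_algebra scale br
  for scale :: "real \<Rightarrow> 'v::ab_group_add \<Rightarrow> 'v" and br +
  fixes a b :: real and e f :: "nat \<Rightarrow> 'v" and z :: 'v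
  assumes basis: "is_basis (basis_ef 2 e f z)"
    and ef: "\<lbrakk>i \<in> {1,2}; j \<in> {1,2}\<rbrakk> \<Longrightarrow> br (e i) (f j) =
      (if i = j then scale (1 + a) z else if i = 1 \<and> j = 2 then scale b z else scale (- b) z)"
    and fe: "\<lbrakk>i \<in> {1,2}; j \<in> {1,2}\<rbrakk> \<Longrightarrow> br (f j) (e i) =
      (if i = j then scale (- 1 + a) z else if i = 1 \<and> j = 2 then scale b z else scale (- b) z)"
    and ee: "\<lbrakk>i \<in> {1,2}; j \<in> {1,2}\<rbrakk> \<Longrightarrow> br (e i) (e j) = 0"
    and ff: "\<lbrakk>i \<in> {1,2}; j \<in> {1,2}\<rbrakk> \<Longrightarrow> br (f i) (f j) = 0"
    and z: "v \<in> set (basis_ef 2 e f z) \<Longrightarrow> br v z = 0 \<and> br z v = 0"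

locale kronecker = bracket_algebra scale br
  for scale :: "'a::field \<Rightarrow> 'v::ab_group_add \<Rightarrow> 'v" and br +
  fixes n :: nat and e f :: "nat \<Rightarrow> 'v" and z :: 'v
  assumes basis: "is_basis (basis_ef n e f z)"
    and ef: "\<lbrakk>i \<in> {1..n}; j \<in> {1..n}\<rbrakk> \<Longrightarrow> br (e i) (f j) =
      (if i = j then z else if i = j + 1 then z else 0)"
    and fe: "\<lbrakk>i \<in> {1..n}; j \<in> {1..n}\<rbrakk> \<Longrightarrow> br (f j) (e i) =
      (if i = j then z else if i = j + 1 then - z else 0)"
    and ee: "\<lbrakk>i \<in> {1..n}; j \<in> {1..n}\<rbrakk> \<Longrightarrow> br (e i) (e j) = 0"
    and ff: "\<lbrakk>i \<in> {1..n}; j \<in> {1..n}\<rbrakk> \<Longrightarrow> br (f i) (f j) = 0"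
    and z: "v \<in> set (basis_ef n e f z) \<Longrightarrow> br v z = 0 \<and> br z v = 0"

text \<open>The natural-number subtractions below are guarded by \<^term>\<open>n + 2 \<le> i\<close>.\<close>

locale dieudonne = bracket_algebra scale br
  for scale :: "'a::field \<Rightarrow> 'v::ab_group_add \<Rightarrow> 'v" and br +
  fixes n :: nat and e :: "nat \<Rightarrow> 'v" and z :: 'v
  assumes basis: "is_basis (basis_e (2*n+1) e z)"
    and ee: "\<lbrakk>i \<in> {1..2*n+1}; j \<in> {1..2*n+1}\<rbrakk> \<Longrightarrow> br (e i) (e j) =
      (if i = 1 \<and> j = n + 2 then z
       else if i \<in> {2..n} \<and> (j = n + i \<or> j = n + i + 1) then z
       else if i = n + 1 \<and> j = 2*n + 1 then z
       else if i \<in> {n+2..2*n+1} \<and> j = i - n then z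
       else if i \<in> {n+2..2*n+1} \<and> j = i - n - 1 then - z
       else 0)"
    and z: "v \<in> set (basis_e (2*n+1) e z) \<Longrightarrow> br v z = 0 \<and> br z v = 0"


section \<open>The algebras are left Leibniz algebras\<close>

lemma (in bracket_algebra) left_leibniz_if_central:
  assumes B: "span B = UNIV"
    and prod: "\<And>v w. v \<in> B \<Longrightarrow> w \<in> B \<Longrightarrow> br v w \<in> span {z}"
    and z: "\<And>v. v \<in> B \<Longrightarrow> br v z = 0 \<and> br z v = 0"
  shows "left_leibniz_algebra scale br"
proof -
  interpret right: Vector_Spaces.linear scale scale "\<lambda>y. br x y" for x by (rule linear_right)
  interpret left: Vector_Spaces.linear scale scale "\<lambda>x. br x y" for y by (rule linear_left)
  have sub: "subspace {x. g x \<in> span S}" if "Vector_Spaces.linear scale scale g" for g S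
  proof -
    interpret g: Vector_Spaces.linear scale scale g by (rule that)
    show ?thesis
      by (auto simp: subspace_def g.zero g.add g.scale span_zero span_add span_scale)
  qed
  have ind: "g x \<in> span S"
    if "Vector_Spaces.linear scale scale g" "\<And>v. v \<in> B \<Longrightarrow> g v \<in> span S" for g S x
    using span_induct[of x B "\<lambda>x. g x \<in> span S"] sub[OF that(1)] that(2) B by auto
  have vz: "br v z = 0" for v
    using ind[of "\<lambda>x. br x z" "{}" v] linear_left z by auto
  have zv: "br z v = 0" for v
    using ind[of "\<lambda>x. br z x" "{}" v] linear_right z by auto
  have "br v y \<in> span {z}" if "v \<in> B" for v y
    using ind[OF linear_right] prod that by blast
  then have "br x y \<in> span {z}" for x y
    using ind[of "\<lambda>x. br x y" "{z}" x] linear_left by blast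
  then have *: "\<exists>c. br x y = scale c z" for x y
    by (auto simp: span_singleton)
  have "br x (br y w) = 0" "br (br x y) w = 0" for x y w
    using *[of y w] *[of x y] by (auto simp: right.scale left.scale vz zv)
  then show ?thesis by unfold_locales simp
qed

lemma basis_efE:
  assumes "v \<in> set (basis_ef n e f z)"
  obtains "v = z" | i where "i \<in> {1..n}" "v = e i \<or> v = f i"
proof -
  have "v = z \<or> (\<exists>i\<in>{1..n}. v = e i \<or> v = f i)"
    using assms by (force simp: less_Suc_eq_le)
  then show thesis using that by blast
qed

lemma (in vector_space) span_singleton_mem:
  "z \<in> span {z}" "- z \<in> span {z}" "0 \<in> span {z}" "scale c z \<in> span {z}"
  by (auto simp: span_zero span_base span_neg span_scale)

sublocale heisenberg_J \<subseteq> left_leibniz_algebra scale br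
proof (rule left_leibniz_if_central)
  show "span (set (basis_ef n e f z)) = UNIV" using basis unfolding is_basis_def by blast
  show "br v z = 0 \<and> br z v = 0" if "v \<in> set (basis_ef n e f z)" for v using z[OF that] .
  fix v w assume v: "v \<in> set (basis_ef n e f z)" and w: "w \<in> set (basis_ef n e f z)"
  show "br v w \<in> span {z}"
  proof (rule basis_efE[OF v])
    assume "v = z"
    then show ?thesis using z[OF w] by (simp only: span_zero)
  next
    fix i assume i': "i \<in> {1..n}" and vi: "v = e i \<or> v = f i"
    show ?thesis
    proof (rule basis_efE[OF w])
      assume "w = z"
      then show ?thesis using z[OF v] by (simp only: span_zero)
    next
      fix j assume j': "j \<in> {1..n}" and wj: "w = e j \<or> w = f j"
      have i: "i \<in> {1..n}" and j: "j \<in> {1..n}" using i' j' by auto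
      show ?thesis
        using vi wj ee[OF i j] ff[OF i j] ef[OF i j] fe[OF j i] span_singleton_mem
        by metis
    qed
  qed
qed

sublocale heisenberg_R \<subseteq> left_leibniz_algebra scale br
proof (rule left_leibniz_if_central)
  show "span (set (basis_ef 2 e f z)) = UNIV" using basis unfolding is_basis_def by blast
  show "br v z = 0 \<and> br z v = 0" if "v \<in> set (basis_ef 2 e f z)" for v using z[OF that] .
  fix v w assume v: "v \<in> set (basis_ef 2 e f z)" and w: "w \<in> set (basis_ef 2 e f z)"
  show "br v w \<in> span {z}"
  proof (rule basis_efE[OF v])
    assume "v = z"
    then show ?thesis using z[OF w] by (simp only: span_zero)
  next
    fix i assume i': "i \<in> {1..2}" and vi: "v = e i \<or> v = f i"
    show ?thesis
    proof (rule basis_efE[OF w])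
      assume "w = z"
      then show ?thesis using z[OF v] by (simp only: span_zero)
    next
      fix j assume j': "j \<in> {1..2}" and wj: "w = e j \<or> w = f j"
      have i: "i \<in> {1,2}" and j: "j \<in> {1,2}" using i' j' by auto
      show ?thesis
        using vi wj ee[OF i j] ff[OF i j] ef[OF i j] fe[OF j i] span_singleton_mem
        by metis
    qed
  qed
qed

sublocale kronecker \<subseteq> left_leibniz_algebra scale br
proof (rule left_leibniz_if_central)
  show "span (set (basis_ef n e f z)) = UNIV" using basis unfolding is_basis_def by blast
  show "br v z = 0 \<and> br z v = 0" if "v \<in> set (basis_ef n e f z)" for v using z[OF that] .
  fix v w assume v: "v \<in> set (basis_ef n e f z)" and w: "w \<in> set (basis_ef n e f z)"
  show "br v w \<in> span {z}"
  proof (rule basis_efE[OF v])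
    assume "v = z"
    then show ?thesis using z[OF w] by (simp only: span_zero)
  next
    fix i assume i': "i \<in> {1..n}" and vi: "v = e i \<or> v = f i"
    show ?thesis
    proof (rule basis_efE[OF w])
      assume "w = z"
      then show ?thesis using z[OF v] by (simp only: span_zero)
    next
      fix j assume j': "j \<in> {1..n}" and wj: "w = e j \<or> w = f j"
      have i: "i \<in> {1..n}" and j: "j \<in> {1..n}" using i' j' by auto
      show ?thesis
        using vi wj ee[OF i j] ff[OF i j] ef[OF i j] fe[OF j i] span_singleton_mem
        by metis
    qed
  qed
qed

sublocale dieudonne \<subseteq> left_leibniz_algebra scale br
proof (rule left_leibniz_if_central)
  show "span (set (basis_e (2*n+1) e z)) = UNIV" using basis unfolding is_basis_def by blast
  show "br v z = 0 \<and> br z v = 0" if "v \<in> set (basis_e (2*n+1) e z)" for v using z[OF that] .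
  fix v w assume vw: "v \<in> set (basis_e (2*n+1) e z)" "w \<in> set (basis_e (2*n+1) e z)"
  have E: "x = z \<or> (\<exists>i\<in>{1..2*n+1}. x = e i)" if "x \<in> set (basis_e (2*n+1) e z)" for x
    using that by (auto simp: less_Suc_eq_le)
  show "br v w \<in> span {z}"
  proof (cases "v = z \<or> w = z")
    case True
    then show ?thesis using z[OF vw(1)] z[OF vw(2)] span_zero by metis
  next
    case False
    then obtain i j where ij: "i \<in> {1..2*n+1}" "j \<in> {1..2*n+1}" and "v = e i" "w = e j"
      using E[OF vw(1)] E[OF vw(2)] by blast
    then show ?thesis
      by (simp only: ee[OF ij] span_singleton_mem split: if_split) simp
  qed
qed

end

theory Submission
  imports Defs
begin

text \<open>Each of the four algebras splits as \<open>L = \<langle>A\<rangle> \<oplus> \<langle>C\<rangle> \<oplus> \<langle>z\<rangle>\<close>, where \<open>z\<close> annihilates \<open>L\<close> on both sides,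
  products within \<open>A\<close> and within \<open>C\<close> vanish, and products between \<open>A\<close> and \<open>C\<close> are multiples of
  \<open>z\<close>, not all zero.  For the algebras with basis \<open>e\<^sub>i, f\<^sub>i, z\<close> the parts are the \<open>e\<^sub>i\<close> and the
  \<open>f\<^sub>i\<close>; for the Dieudonne algebra they are \<open>e\<^sub>1, \<dots>, e\<^sub>n\<^sub>+\<^sub>1\<close> and \<open>e\<^sub>n\<^sub>+\<^sub>2, \<dots>, e\<^sub>2\<^sub>n\<^sub>+\<^sub>1\<close>.
  Both conclusions follow from this bipartite shape.

  Inner derivations commute because \<open>[L, L] \<subseteq> \<langle>z\<rangle>\<close> is annihilated by \<open>L\<close>, so any two of them
  compose to zero.

  A central derivation \<open>D\<close> is tested against two explicit kinds of derivations.  Every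
  linear map \<open>L \<rightarrow> \<langle>z\<rangle>\<close> that kills \<open>z\<close> is a derivation; commuting with those that pick out a single
  coordinate forces \<open>D x \<in> c x + \<langle>z\<rangle>\<close> for the scalar \<open>c\<close> with \<open>D z = c z\<close>
  (lemma \<open>central_scalar_mod_z\<close>).  The
  Leibniz rule at a nonzero product \<open>[x, y]\<close>, itself a multiple of \<open>z\<close>, then reads
  \<open>c [x, y] = 2 c [x, y]\<close>, so \<open>c = 0\<close> and \<open>D\<close> takes values in \<open>\<langle>z\<rangle>\<close>
  (lemma \<open>central_range\<close>).  Finally, the bipartition gives two
  grading derivations, which have eigenvalue \<open>1\<close> on \<open>z\<close> and on one part and eigenvalue \<open>0\<close> on the other
  part.  As \<open>D\<close> preserves their kernels, it sends \<open>A\<close> and \<open>C\<close> to vectors of \<open>\<langle>z\<rangle>\<close> killed by a map that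
  is the identity on \<open>\<langle>z\<rangle>\<close>, that is, to \<open>0\<close> (lemma \<open>central_zero_on_C\<close>).\<close>

section \<open>Bipartite algebras with a one-dimensional product space\<close>

text \<open>The hypotheses are symmetric in \<open>A\<close> and \<open>C\<close>, so each fact about one part also gives the
  fact about the other.\<close>

locale bipartite_algebra = bracket_algebra scale br
  for scale :: "'a::field \<Rightarrow> 'v::ab_group_add \<Rightarrow> 'v" and br +
  fixes A C :: "'v set" and z :: 'v
  assumes indep: "independent (insert z (A \<union> C))"
    and span_UNIV: "span (insert z (A \<union> C)) = UNIV"
    and z_notin: "z \<notin> A \<union> C"
    and disjoint: "A \<inter> C = {}"
    and AA: "\<lbrakk>x \<in> A; y \<in> A\<rbrakk> \<Longrightarrow> br x y = 0"
    and CC: "\<lbrakk>x \<in> C; y \<in> C\<rbrakk> \<Longrightarrow> br x y = 0"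
    and AC: "\<lbrakk>x \<in> A; y \<in> C\<rbrakk> \<Longrightarrow> br x y \<in> span {z}"
    and CA: "\<lbrakk>x \<in> C; y \<in> A\<rbrakk> \<Longrightarrow> br x y \<in> span {z}"
    and z_basis: "v \<in> insert z (A \<union> C) \<Longrightarrow> br v z = 0 \<and> br z v = 0"
    and br_nonzero: "\<exists>x y. br x y \<noteq> 0"
begin

sublocale vs: vector_space_pair scale scale ..

sublocale br_right: Vector_Spaces.linear scale scale "\<lambda>y. br x y" for x
  by (rule linear_right)

sublocale br_left: Vector_Spaces.linear scale scale "\<lambda>x. br x y" for y
  by (rule linear_left)

abbreviation "B \<equiv> insert z (A \<union> C)"

lemma swap: "bipartite_algebra scale br C A z"
  using indep span_UNIV z_notin disjoint AA CC AC CA z_basis br_nonzero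
  by unfold_locales (auto simp: Un_commute)

lemma z_nonzero: "z \<noteq> 0"
  using indep dependent_zero by blast

lemma linear_eq_on_basis:
  assumes "Vector_Spaces.linear scale scale g" "Vector_Spaces.linear scale scale h"
    and "\<And>x. x \<in> B \<Longrightarrow> g x = h x"
  shows "g x = h x"
  using vs.linear_eq_on_span[OF assms] span_UNIV by blast

lemma linear_zero: "Vector_Spaces.linear scale scale (\<lambda>x. 0)"
  by (rule vs.linear_zero)

lemma br_z [simp]: "br v z = 0" and z_br [simp]: "br z v = 0"
  using linear_eq_on_basis[OF linear_left linear_zero, of z]
    linear_eq_on_basis[OF linear_right linear_zero, of z] z_basis by auto

lemma br_in_span_z: "br x y \<in> span {z}"
proof -
  have basis: "br u v \<in> span {z}" if "u \<in> B" "v \<in> B" for u v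
    using that AA CC AC CA by (auto simp: span_zero)
  have sub: "subspace {v. br u v \<in> span {z}}" "subspace {u. br u v \<in> span {z}}" for u v
    by (auto simp: subspace_def br_right.zero br_right.add br_right.scale
        br_left.zero br_left.add br_left.scale span_zero span_add span_scale)
  have "br u y \<in> span {z}" if "u \<in> B" for u
    by (rule span_induct[OF _ sub(1)]) (use span_UNIV basis[OF that] in blast)+
  then show ?thesis
    using span_induct[OF _ sub(2), of x B y] span_UNIV by blast
qed

lemma br_eq_scale_z: obtains k where "br x y = scale k z"
  using br_in_span_z[of x y] by (auto simp: span_singleton)

lemma br_br [simp]: "br x (br y w) = 0"
proof -
  obtain k where "br y w = scale k z" by (rule br_eq_scale_z)
  then show ?thesis by (simp add: br_right.scale)
qed

lemma Inn_abelian: "lie_abelian (Inn br)"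
  by (auto simp: lie_abelian_def Inn_def commutator_def ad_def)


section \<open>A supply of derivations\<close>

text \<open>Both sides of the Leibniz rule are bilinear, so it suffices to check it on the basis.\<close>

lemma Der_if_on_basis:
  assumes d: "Vector_Spaces.linear scale scale d"
    and leib: "\<And>x y. \<lbrakk>x \<in> B; y \<in> B\<rbrakk> \<Longrightarrow> d (br x y) = br (d x) y + br x (d y)"
  shows "d \<in> Der scale br"
proof -
  interpret d: Vector_Spaces.linear scale scale d by (rule d)
  have lin: "Vector_Spaces.linear scale scale (\<lambda>y. d (br x y))"
       "Vector_Spaces.linear scale scale (\<lambda>y. br (d x) y + br x (d y))"
       "Vector_Spaces.linear scale scale (\<lambda>x. d (br x y))"
       "Vector_Spaces.linear scale scale (\<lambda>x. br (d x) y + br x (d y))" for x y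
    by unfold_locales
      (simp_all add: d.add d.scale br_right.add br_right.scale br_left.add br_left.scale
        scale_right_distrib)
  have "d (br x y) = br (d x) y + br x (d y)" if "x \<in> B" for x y
    using linear_eq_on_basis[OF lin(1,2)] leib that by blast
  then have "d (br x y) = br (d x) y + br x (d y)" for x y
    using linear_eq_on_basis[OF lin(3,4)] by blast
  then show ?thesis using d by (simp add: Der_def)
qed

text \<open>The Leibniz rule holds because all of its terms vanish: the map kills \<open>[L, L] \<subseteq> \<langle>z\<rangle>\<close>, and its
  values lie in \<open>\<langle>z\<rangle>\<close>, which is annihilated by the bracket.\<close>

lemma coordinate_Der:
  assumes b: "b \<in> A \<union> C"
  shows "(\<lambda>x. scale (representation B x b) z) \<in> Der scale br" (is "?\<phi> \<in> _")
proof -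
  have [simp]: "representation B z b = 0"
    using representation_basis[OF indep] b z_notin by auto
  have "Vector_Spaces.linear scale scale ?\<phi>"
    by unfold_locales
      (simp_all add: representation_add[OF indep] representation_scale[OF indep] span_UNIV
        scale_left_distrib)
  moreover have "?\<phi> (br x y) = br (?\<phi> x) y + br x (?\<phi> y)" for x y
  proof -
    obtain k where "br x y = scale k z" by (rule br_eq_scale_z)
    then show ?thesis
      by (simp add: representation_scale[OF indep] span_UNIV br_left.scale br_right.scale)
  qed
  ultimately show ?thesis by (simp add: Der_def)
qed

text \<open>A product can be nonzero only between the two parts, and it then has weight \<open>1 + 0 = 1\<close>, the weight
  of \<open>z\<close>: the weights grade the algebra.\<close>

lemma grading_Der:
  obtains d where "d \<in> Der scale br" "\<And>x. x \<in> A \<Longrightarrow> d x = x" "\<And>x. x \<in> C \<Longrightarrow> d x = 0" "d z = z"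
proof -
  obtain d where lin: "Vector_Spaces.linear scale scale d"
    and d: "\<forall>x\<in>B. d x = (if x \<in> C then 0 else x)"
    using vs.linear_independent_extend[OF indep, of "\<lambda>x. if x \<in> C then 0 else x"] by blast
  interpret d: Vector_Spaces.linear scale scale d by (rule lin)
  have dA: "d x = x" if "x \<in> A" for x using d disjoint that by auto
  have dC: "d x = 0" if "x \<in> C" for x using d that by auto
  have dz: "d z = z" using d z_notin by auto
  have d_br: "d (br x y) = br x y" for x y
  proof -
    obtain k where "br x y = scale k z" by (rule br_eq_scale_z)
    then show ?thesis by (simp add: d.scale dz)
  qed
  have "d \<in> Der scale br"
    by (rule Der_if_on_basis[OF lin]) (auto simp: d_br dA dC dz AA CC br_left.zero br_right.zero)
  then show thesis using dA dC dz by (rule that)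
qed


section \<open>The center of the derivation algebra\<close>

lemma center_commute:
  assumes "D \<in> lie_center (Der scale br)" "d \<in> Der scale br"
  shows "D (d x) = d (D x)"
  using assms by (auto simp: lie_center_def commutator_def fun_eq_iff)

text \<open>Commuting with the derivation \<open>x \<mapsto> x\<^sub>b z\<close> says \<open>x\<^sub>b D z = (D x)\<^sub>b z\<close>.  At \<open>x = b\<close> this makes
  \<open>D z\<close> a multiple \<open>c z\<close>, and then it shows that \<open>D x\<close> and \<open>c x\<close> have the same coordinates away from
  \<open>z\<close>.\<close>

lemma central_scalar_mod_z:
  assumes D: "D \<in> lie_center (Der scale br)"
  obtains c where "D z = scale c z" "\<And>x. \<exists>\<mu>. D x = scale c x + scale \<mu> z"
proof -
  have comm: "scale (representation B x b) (D z) = scale (representation B (D x) b) z"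
    if "b \<in> A \<union> C" for x b
  proof -
    interpret D: Vector_Spaces.linear scale scale D
      using D by (simp add: lie_center_def Der_def)
    show ?thesis using center_commute[OF D coordinate_Der[OF that], of x] by (simp add: D.scale)
  qed
  \<comment> \<open>If both parts were empty, then \<open>L = \<langle>z\<rangle>\<close> would have zero bracket.\<close>
  have "A \<union> C \<noteq> {}"
  proof
    assume "A \<union> C = {}"
    then have "br x y = 0" for x y
      using linear_eq_on_basis[OF linear_left linear_zero, of y x] by simp
    then show False using br_nonzero by blast
  qed
  then obtain b where b: "b \<in> A \<union> C" by blast
  define c where "c = representation B (D b) b"
  have Dz: "D z = scale c z"
    using comm[OF b, of b] representation_basis[OF indep, of b] b by (simp add: c_def)
  have "\<exists>\<mu>. D x = scale c x + scale \<mu> z" for x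
  proof -
    define y where "y = D x - scale c x"
    have "representation B y v = 0" if "v \<in> A \<union> C" for v
      using comm[OF that, of x] z_nonzero
      by (simp add: Dz y_def representation_diff[OF indep] representation_scale[OF indep]
          span_UNIV mult.commute)
    then have "{v. representation B y v \<noteq> 0} \<subseteq> {z}"
      using representation_ne_zero[of B y] by blast
    then have "(\<Sum>v | representation B y v \<noteq> 0. scale (representation B y v) v) \<in> span {z}"
      by (intro span_sum span_scale) (auto intro: span_base)
    then have "y \<in> span {z}"
      using sum_nonzero_representation_eq[OF indep, of y] span_UNIV by simp
    then obtain \<mu> where "y = scale \<mu> z" by (auto simp: span_singleton)
    then show ?thesis unfolding y_def by (metis diff_eq_eq add.commute)
  qed
  with Dz show thesis by (rule that)
qed

lemma central_range:
  assumes D: "D \<in> lie_center (Der scale br)"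
  shows "D z = 0" "\<exists>\<mu>. D x = scale \<mu> z"
proof -
  obtain c where Dz: "D z = scale c z" and mod_z: "\<And>x. \<exists>\<mu>. D x = scale c x + scale \<mu> z"
    using central_scalar_mod_z[OF D] by blast
  interpret D: Vector_Spaces.linear scale scale D
    using D by (simp add: lie_center_def Der_def)
  obtain u v where uv: "br u v \<noteq> 0" using br_nonzero by blast
  obtain \<mu> \<nu> where "D u = scale c u + scale \<mu> z" "D v = scale c v + scale \<nu> z"
    using mod_z by blast
  then have "D (br u v) = scale c (br u v) + scale c (br u v)"
    using D by (simp add: lie_center_def Der_def br_left.add br_left.scale
        br_right.add br_right.scale)
  moreover have "D (br u v) = scale c (br u v)"
  proof -
    obtain k where "br u v = scale k z" by (rule br_eq_scale_z)
    then show ?thesis by (simp add: D.scale Dz mult.commute)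
  qed
  ultimately have "c = 0" using uv by simp
  then show "D z = 0" "\<exists>\<mu>. D x = scale \<mu> z" using Dz mod_z[of x] by simp_all
qed

text \<open>The grading derivation \<open>d\<close> kills \<open>x\<close>, hence also kills \<open>D x \<in> \<langle>z\<rangle>\<close>; but \<open>d\<close> fixes \<open>z\<close>.\<close>

lemma central_zero_on_C:
  assumes D: "D \<in> lie_center (Der scale br)" and x: "x \<in> C"
  shows "D x = 0"
proof -
  obtain d where d: "d \<in> Der scale br" "\<And>x. x \<in> C \<Longrightarrow> d x = 0" "d z = z"
    using grading_Der by metis
  interpret D: Vector_Spaces.linear scale scale D
    using D by (simp add: lie_center_def Der_def)
  interpret d: Vector_Spaces.linear scale scale d
    using d(1) by (simp add: Der_def)
  obtain \<mu> where \<mu>: "D x = scale \<mu> z" using central_range(2)[OF D] by blast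
  have "d (D x) = D (d x)" using center_commute[OF D d(1)] by simp
  also have "\<dots> = 0" using d(2)[OF x] by (simp add: D.zero)
  finally show ?thesis by (simp add: \<mu> d.scale d(3))
qed

theorem center_Der: "lie_center (Der scale br) = {\<lambda>x. 0}"
proof (intro equalityI subsetI)
  fix D assume D: "D \<in> lie_center (Der scale br)"
  then have lin: "Vector_Spaces.linear scale scale D" by (simp add: lie_center_def Der_def)
  have "D x = 0" for x
  proof (rule linear_eq_on_basis[OF lin linear_zero])
    fix x assume "x \<in> B"
    then show "D x = 0"
      using central_range(1)[OF D] central_zero_on_C[OF D]
        bipartite_algebra.central_zero_on_C[OF swap D] by blast
  qed
  then show "D \<in> {\<lambda>x. 0}" by auto
next
  fix D :: "'v \<Rightarrow> 'v" assume "D \<in> {\<lambda>x. 0}"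
  moreover have "(\<lambda>x. 0) \<in> Der scale br"
    using linear_zero by (simp add: Der_def br_left.zero br_right.zero)
  moreover have "d 0 = 0" if "d \<in> Der scale br" for d
  proof -
    interpret d: Vector_Spaces.linear scale scale d using that by (simp add: Der_def)
    show ?thesis by (rule d.zero)
  qed
  ultimately show "D \<in> lie_center (Der scale br)"
    by (auto simp: lie_center_def commutator_def)
qed

end


section \<open>The four algebras are bipartite\<close>

lemma set_basis_ef: "set (basis_ef n e f z) = insert z (e ` {1..n} \<union> f ` {1..n})"
  by (auto simp: less_Suc_eq_le)

lemma set_basis_e: "set (basis_e m e z) = insert z (e ` {1..m})"
  by (auto simp: less_Suc_eq_le)

lemma (in vector_space) is_basis_efD:
  assumes "is_basis (basis_ef n e f z)"
  shows "independent (insert z (e ` {1..n} \<union> f ` {1..n}))"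
    and "span (insert z (e ` {1..n} \<union> f ` {1..n})) = UNIV"
    and "z \<notin> e ` {1..n} \<union> f ` {1..n}" and "e ` {1..n} \<inter> f ` {1..n} = {}"
    and "z \<noteq> 0"
proof -
  show indep: "independent (insert z (e ` {1..n} \<union> f ` {1..n}))"
    and "span (insert z (e ` {1..n} \<union> f ` {1..n})) = UNIV"
    using assms unfolding is_basis_def set_basis_ef by blast+
  show "z \<noteq> 0" using indep dependent_zero by blast
  have "set [1..<n+1] = {1..n}" by auto
  then show "z \<notin> e ` {1..n} \<union> f ` {1..n}" "e ` {1..n} \<inter> f ` {1..n} = {}"
    using assms by (auto simp: is_basis_def simp del: set_upt upt_Suc)
qed

text \<open>The products \<open>[e\<^sub>i, f\<^sub>i]\<close> and \<open>[f\<^sub>i, e\<^sub>i]\<close> cannot both vanish for any value of the parameter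
  \<open>a\<close>, since their difference is \<open>2 z\<close>.\<close>

lemma (in vector_space) scale_pm_one_nonzero:
  assumes "v \<noteq> 0" "(2::'a) \<noteq> 0"
  shows "scale (1 + a) v \<noteq> 0 \<or> scale (- 1 + a) v \<noteq> 0"
proof (rule ccontr)
  assume "\<not> ?thesis"
  then have "1 + a = 0" "- 1 + a = 0" using assms(1) by auto
  then have "(1 + a) - (- 1 + a) = 0" by simp
  then show False using assms(2) by simp
qed

lemma heisenberg_J_bipartite:
  assumes "heisenberg_J scale br n a e f z" and n: "n \<ge> 1"
  shows "bipartite_algebra scale br (e ` {1..n}) (f ` {1..n}) z"
proof -
  interpret heisenberg_J scale br n a e f z by fact
  note basis_facts = is_basis_efD[OF basis]
  show ?thesis
  proof unfold_locales
    show "br v z = 0 \<and> br z v = 0" if "v \<in> insert z (e ` {1..n} \<union> f ` {1..n})" for v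
      using z[of v] that unfolding set_basis_ef by blast
    have "br (e 1) (f 1) \<noteq> 0 \<or> br (f 1) (e 1) \<noteq> 0"
      using scale_pm_one_nonzero[OF basis_facts(5), of a] n by (auto simp: ef fe)
    then show "\<exists>x y. br x y \<noteq> 0" by blast
    show "br x y \<in> span {z}" if "x \<in> e ` {1..n}" "y \<in> f ` {1..n}" for x y
      using that by (auto simp: ef span_singleton_mem)
    show "br x y \<in> span {z}" if "x \<in> f ` {1..n}" "y \<in> e ` {1..n}" for x y
      using that by (auto simp: fe span_singleton_mem span_neg)
  qed (use basis_facts(1-4) in \<open>auto simp: ee ff\<close>)
qed

lemma heisenberg_R_bipartite:
  assumes "heisenberg_R scale br a b e f z"
  shows "bipartite_algebra scale br (e ` {1..2}) (f ` {1..2}) z"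
proof -
  interpret heisenberg_R scale br a b e f z by fact
  note basis_facts = is_basis_efD[OF basis]
  have two: "{1..2::nat} = {1,2}" by auto
  show ?thesis
  proof unfold_locales
    show "br v z = 0 \<and> br z v = 0" if "v \<in> insert z (e ` {1..2} \<union> f ` {1..2})" for v
      using z[of v] that unfolding set_basis_ef by blast
    have "br (e 1) (f 1) \<noteq> 0 \<or> br (f 1) (e 1) \<noteq> 0"
      using scale_pm_one_nonzero[OF basis_facts(5), of a] by (auto simp: ef fe)
    then show "\<exists>x y. br x y \<noteq> 0" by blast
    show "br x y \<in> span {z}" if "x \<in> e ` {1..2}" "y \<in> f ` {1..2}" for x y
      using that unfolding two by (auto simp: ef span_singleton_mem span_neg)
    show "br x y \<in> span {z}" if "x \<in> f ` {1..2}" "y \<in> e ` {1..2}" for x y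
      using that unfolding two by (auto simp: fe span_singleton_mem span_neg)
    show "br x y = 0" if "x \<in> e ` {1..2}" "y \<in> e ` {1..2}" for x y
      using that unfolding two by (auto simp: ee)
    show "br x y = 0" if "x \<in> f ` {1..2}" "y \<in> f ` {1..2}" for x y
      using that unfolding two by (auto simp: ff)
  qed (use basis_facts(1-4) in blast)+
qed

lemma kronecker_bipartite:
  assumes "kronecker scale br n e f z" and n: "n \<ge> 1"
  shows "bipartite_algebra scale br (e ` {1..n}) (f ` {1..n}) z"
proof -
  interpret kronecker scale br n e f z by fact
  note basis_facts = is_basis_efD[OF basis]
  show ?thesis
  proof unfold_locales
    show "br v z = 0 \<and> br z v = 0" if "v \<in> insert z (e ` {1..n} \<union> f ` {1..n})" for v
      using z[of v] that unfolding set_basis_ef by blast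
    have "br (e 1) (f 1) = z" using n by (simp add: ef)
    then show "\<exists>x y. br x y \<noteq> 0" using basis_facts(5) by blast
    show "br x y \<in> span {z}" if "x \<in> e ` {1..n}" "y \<in> f ` {1..n}" for x y
      using that by (auto simp: ef span_singleton_mem)
    show "br x y \<in> span {z}" if "x \<in> f ` {1..n}" "y \<in> e ` {1..n}" for x y
      using that by (auto simp: fe span_singleton_mem span_neg)
  qed (use basis_facts(1-4) in \<open>auto simp: ee ff\<close>)
qed

text \<open>The cut lies between the indices \<open>n + 1\<close> and \<open>n + 2\<close>: in each nonzero product one index is at
  most \<open>n + 1\<close> and the other is at least \<open>n + 2\<close>.  The parts thus have different sizes,
  \<open>n + 1\<close> and \<open>n\<close>.\<close>

lemma dieudonne_bipartite:
  assumes "dieudonne scale br n e z" and n: "n \<ge> 1"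
  shows "bipartite_algebra scale br (e ` {1..n+1}) (e ` {n+2..2*n+1}) z"
proof -
  interpret dieudonne scale br n e z by fact
  have range: "{1..2*n+1} = {1..n+1} \<union> {n+2..2*n+1}" by auto
  have set: "set (basis_e (2*n+1) e z) = insert z (e ` {1..n+1} \<union> e ` {n+2..2*n+1})"
    unfolding set_basis_e range image_Un ..
  have inj: "inj_on e {1..2*n+1}" and z_notin: "z \<notin> e ` {1..2*n+1}"
  proof -
    have "set [1..<2*n+1+1] = {1..2*n+1}" by auto
    then show "inj_on e {1..2*n+1}" "z \<notin> e ` {1..2*n+1}"
      using basis by (auto simp: is_basis_def distinct_map simp del: set_upt upt_Suc)
  qed
  have indep: "independent (insert z (e ` {1..n+1} \<union> e ` {n+2..2*n+1}))"
    using basis unfolding is_basis_def set by blast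
  then have "z \<noteq> 0" using dependent_zero by blast
  have br_in: "br (e i) (e j) \<in> span {z}" if "i \<in> {1..2*n+1}" "j \<in> {1..2*n+1}" for i j
    by (simp add: ee[OF that] span_singleton_mem)
  show ?thesis
  proof unfold_locales
    show "br v z = 0 \<and> br z v = 0" if "v \<in> insert z (e ` {1..n+1} \<union> e ` {n+2..2*n+1})" for v
      using z[of v] that unfolding set by blast
    show "independent (insert z (e ` {1..n+1} \<union> e ` {n+2..2*n+1}))" by (rule indep)
    show "span (insert z (e ` {1..n+1} \<union> e ` {n+2..2*n+1})) = UNIV"
      using basis unfolding is_basis_def set by blast
    show "z \<notin> e ` {1..n+1} \<union> e ` {n+2..2*n+1}"
      using z_notin unfolding range image_Un .
    show "e ` {1..n+1} \<inter> e ` {n+2..2*n+1} = {}"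
      using inj_on_image_Int[OF inj, of "{1..n+1}" "{n+2..2*n+1}"] by auto
    have "br (e 1) (e (n + 2)) = z" using n by (subst ee) auto
    then show "\<exists>x y. br x y \<noteq> 0" using \<open>z \<noteq> 0\<close> by blast
    show "br x y = 0" if "x \<in> e ` {1..n+1}" "y \<in> e ` {1..n+1}" for x y
      using that n by (auto simp: ee)
    show "br x y = 0" if "x \<in> e ` {n+2..2*n+1}" "y \<in> e ` {n+2..2*n+1}" for x y
      using that n by (auto simp: ee)
  qed (use br_in in auto)
qed


section \<open>Center and inner derivations\<close>

theorem mainTheorem6:
  fixes n :: nat
    and scaleC :: "complex \<Rightarrow> 'u::ab_group_add \<Rightarrow> 'u" and brC :: "'u \<Rightarrow> 'u \<Rightarrow> 'u"
    and \<alpha> :: complex and eC fC :: "nat \<Rightarrow> 'u" and zC :: 'u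
    and scaleR :: "real \<Rightarrow> 'v::ab_group_add \<Rightarrow> 'v" and brR :: "'v \<Rightarrow> 'v \<Rightarrow> 'v"
    and a b :: real and eR fR :: "nat \<Rightarrow> 'v" and zR :: 'v
    and scale :: "'a::field \<Rightarrow> 'w::ab_group_add \<Rightarrow> 'w" and br :: "'w \<Rightarrow> 'w \<Rightarrow> 'w"
    and e f :: "nat \<Rightarrow> 'w" and z :: 'w
  assumes "n \<ge> 1"
  shows "(heisenberg_J scaleC brC n \<alpha> eC fC zC \<longrightarrow>
            lie_center (Der scaleC brC) = {\<lambda>x. 0} \<and> lie_abelian (Inn brC)) \<and>
         (heisenberg_R scaleR brR a b eR fR zR \<and> b \<noteq> 0 \<longrightarrow>
            lie_center (Der scaleR brR) = {\<lambda>x. 0} \<and> lie_abelian (Inn brR)) \<and>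
         (kronecker scale br n e f z \<and> CHAR('a) \<noteq> 2 \<longrightarrow>
            lie_center (Der scale br) = {\<lambda>x. 0} \<and> lie_abelian (Inn br)) \<and>
         (dieudonne scale br n e z \<and> CHAR('a) \<noteq> 2 \<longrightarrow>
            lie_center (Der scale br) = {\<lambda>x. 0} \<and> lie_abelian (Inn br))"
proof (intro conjI impI; (elim conjE)?)
  assume "heisenberg_J scaleC brC n \<alpha> eC fC zC"
  note bip = heisenberg_J_bipartite[OF this \<open>n \<ge> 1\<close>]
  show "lie_center (Der scaleC brC) = {\<lambda>x. 0}" "lie_abelian (Inn brC)"
    by (fact bipartite_algebra.center_Der[OF bip] bipartite_algebra.Inn_abelian[OF bip])+
next
  assume "heisenberg_R scaleR brR a b eR fR zR"
  note bip = heisenberg_R_bipartite[OF this]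
  show "lie_center (Der scaleR brR) = {\<lambda>x. 0}" "lie_abelian (Inn brR)"
    by (fact bipartite_algebra.center_Der[OF bip] bipartite_algebra.Inn_abelian[OF bip])+
next
  assume "kronecker scale br n e f z"
  note bip = kronecker_bipartite[OF this \<open>n \<ge> 1\<close>]
  show "lie_center (Der scale br) = {\<lambda>x. 0}" "lie_abelian (Inn br)"
    by (fact bipartite_algebra.center_Der[OF bip] bipartite_algebra.Inn_abelian[OF bip])+
next
  assume "dieudonne scale br n e z"
  note bip = dieudonne_bipartite[OF this \<open>n \<ge> 1\<close>]
  show "lie_center (Der scale br) = {\<lambda>x. 0}" "lie_abelian (Inn br)"
    by (fact bipartite_algebra.center_Der[OF bip] bipartite_algebra.Inn_abelian[OF bip])+
qed

end
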